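(* Let $\Psi$ be a finite (possibly empty) composition of $U$ and $V$, let $\Psi(ab)=\Pi_1\Pi_2$ be its unique factorization into two nonempty palindromes, and put $\Pi=\Pi_1\Pi_2$. For an integer $k\ge1$ let $r^{\Psi}_k=\rho_{C}$ where $C$ is the chain $\Pi_2\Pi^k$ (i.e. $\Pi_2$ followed by $k$ copies of $\Pi$). Write the chain of $\Pi$ as $[p_1\dots p_m]$ and the chain of $\Pi_2\Pi^{k-1}$ as $[c_1\dots c_l]$. Then $$\mathcal{Z}(r^{\Psi}_k)=\Big([p_1;p_2,\dots,p_m]+[0;c_1,c_2,\dots,c_l]\Big)^{-1}.$$
   Context: Write $a=[22]$ and $b=[11]$; a word in $a,b$ is identified with the chain (finite sequence of positive integers) obtained by concatenation. For a chain $S=[s_1\dots s_m]$, $\rho_S=[0;s_1,\dots,s_m]$ and $[s_1;s_2,\dots,s_m]=1/\rho_S$ are finite continued fractions. For a rational $x=p/q$ in lowest terms with $q\ge2$, $\mathcal{Z}(x)=\min_{0<q'<q}q'\|q'x\|$, $\|\cdot\|$ being distance to the nearest integer; equivalently, if $x=[0;a_1,\dots,a_n]$ then $\mathcal{Z}(x)=\big(\max_{1\le i\le n}([a_i;a_{i+1},\dots,a_n]+[0;a_{i-1},\dots,a_1])\big)^{-1}$. The Nielsen moves are the substitutions $U:a\mapsto ab,\ b\mapsto b$ and $V:a\mapsto a,\ b\mapsto ab$. *)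

theory Defs
  imports Complex_Main
begin

datatype letter = LA | LB

type_synonym word = "letter list"

fun chain_of_letter :: "letter \<Rightarrow> nat list" where
  "chain_of_letter LA = [2,2]"
| "chain_of_letter LB = [1,1]"

definition chain :: "word \<Rightarrow> nat list" where
  "chain w = concat (map chain_of_letter w)"

datatype move = MU | MV

fun move_letter :: "move \<Rightarrow> letter \<Rightarrow> word" where
  "move_letter MU LA = [LA, LB]"
| "move_letter MU LB = [LB]"
| "move_letter MV LA = [LA]"
| "move_letter MV LB = [LA, LB]"

definition apply_move :: "move \<Rightarrow> word \<Rightarrow> word" where
  "apply_move m w = concat (map (move_letter m) w)"

definition apply_moves :: "move list \<Rightarrow> word \<Rightarrow> word" where
  "apply_moves ms w = foldr apply_move ms w"

definition palindrome :: "'a list \<Rightarrow> bool" where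
  "palindrome xs \<longleftrightarrow> rev xs = xs"

fun cfrac :: "nat list \<Rightarrow> rat" where
  "cfrac [] = 0"
| "cfrac [x] = of_nat x"
| "cfrac (x # xs) = of_nat x + 1 / cfrac xs"

definition rho :: "nat list \<Rightarrow> rat" where
  "rho S = (if S = [] then 0 else 1 / cfrac S)"

definition dist_int :: "rat \<Rightarrow> rat" where
  "dist_int y = min (y - of_int \<lfloor>y\<rfloor>) (of_int \<lceil>y\<rceil> - y)"

definition Zfun :: "rat \<Rightarrow> rat" where
  "Zfun x = (let q = snd (quotient_of x) in
     Min {of_int q' * dist_int (of_int q' * x) | q'. 0 < q' \<and> q' < q})"

end

theory Submission
  imports Defs
begin

text \<open>
  For \<open>x = [0; c\<^sub>1, \<dots>, c\<^sub>N]\<close> the law of best approximation reduces the minimum defining \<open>Zfun x\<close>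
  to the denominators of convergents, one for each cut \<open>A | B\<close> of the chain with \<open>B\<close> nonempty;
  such a cut contributes \<open>1 / ([B] + [0; rev A])\<close>.

  To find the best cut, read a word as a lattice path in which every \<open>a\<close> is a step \<open>+ #b\<close> and every
  \<open>b\<close> a step \<open>- #a\<close>, where \<open>#a, #b\<close> count the letters of \<open>\<Pi>\<close>. Both Nielsen moves preserve the fact
  that the path of \<open>\<Pi>\<close> runs from 0 to 0 inside \<open>[0, #a + #b)\<close>. In this strip, of two paths that read
  different letters for the first time the lower one reads \<open>a\<close> and the higher one \<open>b\<close>; as \<open>\<rho>\<close> is
  lexicographically increasing with \<open>a < b\<close>, starting lower means having the smaller \<open>\<rho>\<close>.
  Now \<open>\<Pi>\<close> starts at the lowest height and \<open>\<Pi>\<^sub>2\<close> at the highest, so the cut \<open>\<Pi>\<^sub>2 \<Pi>\<^sup>k\<^sup>-\<^sup>1 | \<Pi>\<close> maximises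
  both summands. Cuts inside a letter are mirror images of cuts between letters, because
  \<open>\<Pi>\<^sub>2 \<Pi>\<^sup>k\<close> is a palindrome.
\<close>

section \<open>Continuants\<close>

text \<open>\<open>continuant_tl\<close> is the continuant of the tail, with 0 for the empty list,
  so that for positive quotients \<open>rho B\<close> is
  \<open>continuant_tl B / continuant B\<close> even when \<open>B\<close> is empty.\<close>

fun continuant :: "nat list \<Rightarrow> int" and continuant_tl :: "nat list \<Rightarrow> int" where
  "continuant [] = 1"
| "continuant (c # B) = int c * continuant B + continuant_tl B"
| "continuant_tl [] = 0"
| "continuant_tl (c # B) = continuant B"

text \<open>Numerators of the last two convergents of \<open>[0; rev R]\<close>: the partial quotients are consumed
  from the end, and the corresponding denominators are \<open>continuant R\<close> and \<open>continuant_tl R\<close>.\<close>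

fun cnum :: "nat list \<Rightarrow> int" and cnum_prev :: "nat list \<Rightarrow> int" where
  "cnum [] = 0"
| "cnum (c # R) = int c * cnum R + cnum_prev R"
| "cnum_prev [] = 1"
| "cnum_prev (c # R) = cnum R"

lemma continuant_pos:
  "0 \<notin> set B \<Longrightarrow> 0 < continuant B \<and> 0 \<le> continuant_tl B"
proof (induction B)
  case (Cons c B)
  then have "0 < int c * continuant B" by (intro mult_pos_pos) auto
  with Cons show ?case by (auto intro!: add_pos_nonneg)
qed simp

text \<open>Splitting of a continuant at a cut. The left part is held reversed, so that moving the
  cut one place to the right is a \<open>Cons\<close>.\<close>

lemma continuant_rev_append:
  "continuant (rev R @ B) = continuant R * continuant B + continuant_tl R * continuant_tl B"
  by (induction R arbitrary: B) (auto simp: algebra_simps)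

lemma continuant_tl_rev_append:
  "continuant_tl (rev R @ B) = cnum R * continuant B + cnum_prev R * continuant_tl B"
  by (induction R arbitrary: B) (auto simp: algebra_simps)

lemma continuant_rev: "continuant (rev R) = continuant R"
  using continuant_rev_append[of R "[]"] by simp

lemma convergent_det:
  "cnum R * continuant_tl R - cnum_prev R * continuant R = (- 1) ^ Suc (length R)"
proof (induction R)
  case (Cons c R)
  have "cnum (c # R) * continuant_tl (c # R) - cnum_prev (c # R) * continuant (c # R)
      = - (cnum R * continuant_tl R - cnum_prev R * continuant R)"
    by (simp add: algebra_simps)
  with Cons show ?case by simp
qed simp

lemma coprime_continuant: "coprime (continuant_tl B) (continuant B)"
proof (induction B)
  case (Cons c B)
  have "gcd (continuant B) (int c * continuant B + continuant_tl B) = gcd (continuant B) (continuant_tl B)"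
    using gcd_add_mult[of "continuant B" "int c" "continuant_tl B"] by (simp add: add.commute)
  with Cons show ?case by (simp add: coprime_iff_gcd_eq_1 gcd.commute)
qed simp

lemma cfrac_Cons: "B \<noteq> [] \<Longrightarrow> cfrac (c # B) = of_nat c + 1 / cfrac B"
  by (cases B) auto

lemma cfrac_eq_continuant:
  "B \<noteq> [] \<Longrightarrow> 0 \<notin> set B \<Longrightarrow> cfrac B = of_int (continuant B) / of_int (continuant_tl B)"
proof (induction B)
  case (Cons c B)
  show ?case
  proof (cases "B = []")
    case False
    then have "cfrac (c # B) = of_nat c + of_int (continuant_tl B) / of_int (continuant B)"
      using Cons by (simp add: cfrac_Cons)
    moreover have "continuant B \<noteq> 0" using continuant_pos[of B] Cons.prems by auto
    ultimately show ?thesis by (simp add: field_simps)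
  qed simp
qed simp

lemma rho_eq_continuant:
  "0 \<notin> set B \<Longrightarrow> rho B = of_int (continuant_tl B) / of_int (continuant B)"
  by (cases "B = []") (simp_all add: rho_def cfrac_eq_continuant)

lemma rho_nonneg: "0 \<le> rho B"
proof -
  have "0 \<le> cfrac B" by (induction B rule: cfrac.induct) auto
  then show ?thesis by (simp add: rho_def)
qed

lemma rho_Cons: "rho (c # B) = 1 / (of_nat c + rho B)"
  by (cases "B = []") (simp_all add: rho_def cfrac_Cons)

lemma cfrac_Cons_rho: "cfrac (c # B) = of_nat c + rho B"
  by (cases "B = []") (simp_all add: rho_def cfrac_Cons)

lemma cfrac_eq_inverse_rho: "B \<noteq> [] \<Longrightarrow> cfrac B = inverse (rho B)"
  by (simp add: rho_def)

text \<open>Over the common denominator the numerator is the splitting formula, which depends on the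
  whole chain only.\<close>

lemma cut_value:
  assumes "0 \<notin> set (rev R @ c # B)"
  shows "cfrac (c # B) + rho R
    = of_int (continuant (rev R @ c # B)) / of_int (continuant R * continuant B)"
proof -
  have pos: "0 < continuant R" "0 < continuant B"
    using assms continuant_pos[of R] continuant_pos[of B] by auto
  have "cfrac (c # B) + rho R = of_int (continuant (c # B)) / of_int (continuant B)
      + of_int (continuant_tl R) / of_int (continuant R)"
    using assms cfrac_eq_continuant[of "c # B"] rho_eq_continuant[of R] by simp
  also have "\<dots> = of_int (continuant R * continuant (c # B) + continuant_tl R * continuant B)
      / of_int (continuant R * continuant B)"
    using pos by (simp add: field_simps del: continuant.simps)
  finally show ?thesis by (simp add: continuant_rev_append del: continuant.simps(2))
qed

section \<open>Best approximation\<close>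

text \<open>In coordinates \<open>m\<close>, \<open>l\<close> for the basis of two consecutive
  convergents, a \<open>q'\<close> between their denominators forces \<open>l\<close> to be nonzero
  and \<open>m\<close> to be zero or of opposite sign. The two parts of the error then cannot
  cancel.\<close>

lemma best_approximation:
  fixes q' p' :: int
  assumes pos: "0 \<notin> set (rev R @ c # B)"
    and low: "continuant R \<le> q'" and high: "q' < continuant (c # R)"
  shows "continuant B \<le> \<bar>q' * continuant_tl (rev R @ c # B) - p' * continuant (rev R @ c # B)\<bar>"
proof -
  define k k' P P' K K' where defs: "k = continuant (c # R)" "k' = continuant R"
    "P = cnum (c # R)" "P' = cnum R" "K = continuant B" "K' = continuant_tl B"
  have k': "0 < k'" and K: "0 < K" "0 \<le> K'"
    using pos continuant_pos[of R] continuant_pos[of B] by (auto simp: defs)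
  have q: "continuant (rev R @ c # B) = k * K + k' * K'"
    using continuant_rev_append[of "c # R" B] by (simp add: defs)
  have p: "continuant_tl (rev R @ c # B) = P * K + P' * K'"
    using continuant_tl_rev_append[of "c # R" B] by (simp add: defs)
  obtain e :: int where e: "P * k' - P' * k = e" and e1: "e = 1 \<or> e = - 1"
    using convergent_det[of "c # R"] by (auto simp: defs power_eq_1_iff minus_one_power_iff)
  have ee: "e * e = 1" using e1 by auto
  \<comment> \<open>coordinates of \<open>(q', p')\<close> in the unimodular basis \<open>(k, P)\<close>, \<open>(k', P')\<close>\<close>
  define m l where ml: "m = e * (p' * k' - q' * P')" "l = e * (q' * P - p' * k)"
  have "m * k + l * k' = e * q' * (P * k' - P' * k)" by (simp add: ml algebra_simps)
  then have q': "q' = m * k + l * k'" using e ee by (simp add: mult.commute mult.left_commute)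
  have "q' * (P * K + P' * K') - p' * (k * K + k' * K') = (e * e) * ((q' * P - p' * k) * K - (p' * k' - q' * P') * K')"
    unfolding ee by (simp add: algebra_simps)
  also have "\<dots> = e * (l * K - m * K')" by (simp add: ml algebra_simps)
  finally have err: "\<bar>q' * (P * K + P' * K') - p' * (k * K + k' * K')\<bar> = \<bar>l * K - m * K'\<bar>"
    using e1 by auto
  have range: "k' \<le> m * k + l * k'" "m * k + l * k' < k" using low high q' by (auto simp: defs)
  then have k: "k' < k" by simp
  have "K \<le> \<bar>l * K - m * K'\<bar>"
  proof (cases l "0 :: int" rule: linorder_cases)
    case less
    have "0 < m"
    proof (rule ccontr)
      assume "\<not> 0 < m"
      then have "m * k \<le> 0" "l * k' \<le> 0" using k k' less by (auto intro: mult_nonpos_nonneg)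
      with range k' show False by linarith
    qed
    moreover have "l * K \<le> - 1 * K" using K less by (intro mult_right_mono) auto
    ultimately have "0 \<le> m * K'" "l * K \<le> - K" using K by auto
    then show ?thesis by linarith
  next
    \<comment> \<open>This case is contradictory: no multiple of \<open>k\<close> lies strictly
      between 0 and \<open>k\<close>.\<close>
    case equal
    then have "0 < m * k" "m * k < 1 * k" using range k' by auto
    then have "0 < m" "m < 1" using k k' by (auto simp: zero_less_mult_iff mult_less_cancel_right)
    then show ?thesis by simp
  next
    case greater
    have "m \<le> 0"
    proof (rule ccontr)
      assume "\<not> m \<le> 0"
      then have "1 * k \<le> m * k" "0 \<le> l * k'" using k k' greater by (auto intro!: mult_right_mono)
      with range k' show False by linarith
    qed
    then have "m * K' \<le> 0" "1 * K \<le> l * K"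
      using K greater by (auto intro: mult_nonpos_nonneg intro!: mult_right_mono)
    then show ?thesis by linarith
  qed
  then show ?thesis using err by (simp add: q p defs)
qed

text \<open>The denominators start at or below \<open>q'\<close> and end above it, so some step of
  the cut crosses \<open>q'\<close>.\<close>

lemma exists_convergent_cut:
  assumes "continuant R \<le> q'" "q' < continuant (rev R @ B)"
  shows "\<exists>R' c B'. rev R @ B = rev R' @ c # B' \<and> continuant R' \<le> q' \<and> q' < continuant (c # R')"
  using assms
proof (induction B arbitrary: R)
  case Nil
  then show ?case by (simp add: continuant_rev)
next
  case (Cons c B)
  show ?case
  proof (cases "q' < continuant (c # R)")
    case True
    with Cons.prems show ?thesis by blast
  next
    case False
    with Cons.IH[of "c # R"] Cons.prems show ?thesis by simp
  qed
qed

section \<open>Reduction of \<open>Zfun\<close> to the cuts of the chain\<close>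

lemma dist_int_le: "dist_int y \<le> \<bar>y - of_int n\<bar>"
proof (cases "n \<le> \<lfloor>y\<rfloor>")
  case True
  then have "y - of_int \<lfloor>y\<rfloor> \<le> y - of_int n" by simp
  then show ?thesis unfolding dist_int_def by linarith
next
  case False
  then have "\<lceil>y\<rceil> \<le> n" by linarith
  then have "of_int \<lceil>y\<rceil> - y \<le> of_int n - y" by simp
  then show ?thesis unfolding dist_int_def by linarith
qed

lemma dist_int_attained: "\<exists>n. dist_int y = \<bar>y - of_int n\<bar>"
proof (cases "dist_int y = y - of_int \<lfloor>y\<rfloor>")
  case True
  then show ?thesis by (intro exI[of _ "\<lfloor>y\<rfloor>"]) simp
next
  case False
  then have "dist_int y = of_int \<lceil>y\<rceil> - y" unfolding dist_int_def by linarith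
  moreover have "\<bar>y - of_int \<lceil>y\<rceil>\<bar> = of_int \<lceil>y\<rceil> - y"
    using le_of_int_ceiling[of y] by linarith
  ultimately show ?thesis by metis
qed

theorem Zfun_rho_eq_max_cut:
  assumes pos: "0 \<notin> set (rev R0 @ c0 # B0)" and ne: "R0 \<noteq> []"
    and max: "\<And>R c B. rev R @ c # B = rev R0 @ c0 # B0
      \<Longrightarrow> cfrac (c # B) + rho R \<le> cfrac (c0 # B0) + rho R0"
  shows "Zfun (rho (rev R0 @ c0 # B0)) = inverse (cfrac (c0 # B0) + rho R0)"
proof -
  define C where "C = rev R0 @ c0 # B0"
  define q p where qp: "q = continuant C" "p = continuant_tl C"
  define f where "f q' = of_int q' * dist_int (of_int q' * rho C)" for q' :: int
  have q: "0 < q" using continuant_pos[of C] pos by (auto simp: qp C_def)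
  have rho: "rho C = of_int p / of_int q" using rho_eq_continuant[of C] pos by (simp add: qp C_def)
  have err: "\<bar>of_int q' * rho C - of_int n\<bar> = of_int \<bar>q' * p - n * q\<bar> / of_int q" for q' n :: int
  proof -
    have "of_int q' * rho C - of_int n = of_int (q' * p - n * q) / of_int q"
      using q by (simp add: rho field_simps)
    then show ?thesis using q by (simp add: abs_divide)
  qed
  have "quotient_of (rho C) = (p, q)"
    using rho q coprime_continuant[of C]
    by (metis Fract_of_int_quotient normalize_stable qp quotient_of_Fract)
  then have Z: "Zfun (rho C) = Min (f ` {0<..<q})"
    by (auto simp: Zfun_def f_def intro!: arg_cong[where f = Min])
  have contR0: "0 < continuant R0" "0 < continuant B0" "0 < continuant_tl R0"
    using pos ne continuant_pos[of R0] continuant_pos[of B0] continuant_pos[of "tl R0"]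
    by (cases R0; auto)+
  have q_eq: "q = continuant R0 * continuant (c0 # B0) + continuant_tl R0 * continuant B0"
    by (simp add: qp C_def continuant_rev_append)
  have "0 < continuant (c0 # B0)" using pos continuant_pos[of "c0 # B0"] by auto
  \<comment> \<open>A nonempty \<open>R0\<close> makes the second summand of \<open>q\<close>
    positive, so \<open>continuant R0\<close> is an admissible \<open>q'\<close>.\<close>
  then have "continuant R0 * 1 \<le> continuant R0 * continuant (c0 # B0)"
    using contR0 by (intro mult_left_mono) auto
  moreover have "0 < continuant_tl R0 * continuant B0" using contR0 by simp
  ultimately have R0_in: "continuant R0 \<in> {0<..<q}" using contR0 q_eq
    unfolding greaterThanLessThan_iff by linarith
  have inv_value: "inverse (cfrac (c # B) + rho R) = of_int (continuant R * continuant B) / of_int q"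
    if "rev R @ c # B = C" for R c B
    using cut_value[of R c B] that pos by (simp add: qp C_def)
  define M where "M = inverse (cfrac (c0 # B0) + rho R0)"
  have lower: "M \<le> f q'" if q'_in: "q' \<in> {0<..<q}" for q'
  proof -
    obtain R c B where cut: "C = rev R @ c # B" "continuant R \<le> q'" "q' < continuant (c # R)"
      using exists_convergent_cut[of "[]" q' C] q'_in by (auto simp: qp)
    obtain n where n: "dist_int (of_int q' * rho C) = \<bar>of_int q' * rho C - of_int n\<bar>"
      using dist_int_attained by blast
    have posRB: "0 < continuant R" "0 < continuant B"
      using pos cut(1) continuant_pos[of R] continuant_pos[of B] unfolding C_def by auto
    have "0 < cfrac (c # B) + rho R"
      using cut_value[of R c B] cut(1) pos posRB q by (simp add: C_def qp)
    then have "M \<le> inverse (cfrac (c # B) + rho R)"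
      unfolding M_def using max[of R c B] cut(1) by (intro le_imp_inverse_le) (auto simp: C_def)
    also have "\<dots> = of_int (continuant R * continuant B) / of_int q"
      using inv_value cut(1) by simp
    also have "\<dots> \<le> of_int (q' * \<bar>q' * p - n * q\<bar>) / of_int q"
    proof -
      have "continuant B \<le> \<bar>q' * p - n * q\<bar>"
        using best_approximation[of R c B q' n] cut pos unfolding qp C_def by simp
      then have "continuant R * continuant B \<le> q' * \<bar>q' * p - n * q\<bar>"
        using cut(2) posRB by (intro mult_mono) auto
      then have "(of_int (continuant R * continuant B) :: rat) \<le> of_int (q' * \<bar>q' * p - n * q\<bar>)"
        by (simp only: of_int_le_iff)
      then show ?thesis using q by (intro divide_right_mono) auto
    qed
    also have "\<dots> = f q'" unfolding f_def n err by simp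
    finally show ?thesis .
  qed
  have "f (continuant R0) \<le> M"
  proof -
    \<comment> \<open>With the convergent's own numerator \<open>cnum R0\<close> as the nearby
      integer, the determinant makes the error exactly \<open>continuant B0\<close>.\<close>
    let ?e = "continuant R0 * p - cnum R0 * q"
    have "?e = continuant B0 * (- (cnum R0 * continuant_tl R0 - cnum_prev R0 * continuant R0))"
      by (simp add: qp C_def continuant_rev_append continuant_tl_rev_append algebra_simps)
    then have "\<bar>?e\<bar> = continuant B0"
      unfolding convergent_det using contR0 by (simp add: abs_mult power_abs)
    then have "dist_int (of_int (continuant R0) * rho C) \<le> of_int (continuant B0) / of_int q"
      using dist_int_le[of "of_int (continuant R0) * rho C" "cnum R0"] err[of "continuant R0" "cnum R0"]
      by simp
    then have "f (continuant R0) \<le> of_int (continuant R0) * (of_int (continuant B0) / of_int q)"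
      unfolding f_def using contR0 by (intro mult_left_mono) auto
    then show ?thesis using inv_value[of R0 c0 B0] by (simp add: M_def C_def)
  qed
  then have "f (continuant R0) = M" using lower[OF R0_in] by simp
  then have "Min (f ` {0<..<q}) = M"
    using R0_in lower by (intro Min_eqI) auto
  then show ?thesis using Z by (simp add: M_def C_def)
qed

section \<open>Words as lattice paths in a strip\<close>

fun step :: "int \<Rightarrow> int \<Rightarrow> letter \<Rightarrow> int" where
  "step \<alpha> \<beta> LA = \<alpha>"
| "step \<alpha> \<beta> LB = - \<beta>"

fun rise :: "int \<Rightarrow> int \<Rightarrow> word \<Rightarrow> int" where
  "rise \<alpha> \<beta> [] = 0"
| "rise \<alpha> \<beta> (l # w) = step \<alpha> \<beta> l + rise \<alpha> \<beta> w"

fun in_strip :: "int \<Rightarrow> int \<Rightarrow> int \<Rightarrow> word \<Rightarrow> bool" where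
  "in_strip \<alpha> \<beta> y [] \<longleftrightarrow> 0 \<le> y \<and> y < \<alpha> + \<beta>"
| "in_strip \<alpha> \<beta> y (l # w) \<longleftrightarrow> 0 \<le> y \<and> y < \<alpha> + \<beta> \<and> in_strip \<alpha> \<beta> (y + step \<alpha> \<beta> l) w"

lemma rise_append [simp]: "rise \<alpha> \<beta> (u @ v) = rise \<alpha> \<beta> u + rise \<alpha> \<beta> v"
  by (induction u) auto

lemma rise_rev [simp]: "rise \<alpha> \<beta> (rev w) = rise \<alpha> \<beta> w"
  by (induction w) auto

lemma rise_concat_replicate [simp]:
  "rise \<alpha> \<beta> (concat (replicate k w)) = int k * rise \<alpha> \<beta> w"
  by (induction k) (auto simp: algebra_simps)

lemma rise_eq_count:
  "rise \<alpha> \<beta> w = \<alpha> * int (count_list w LA) - \<beta> * int (count_list w LB)"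
proof (induction w)
  case (Cons l w)
  then show ?case by (cases l) (auto simp: algebra_simps)
qed simp

lemma length_eq_count: "length w = count_list w LA + count_list w LB"
proof (induction w)
  case (Cons l w)
  then show ?case by (cases l) auto
qed simp

lemma in_strip_start: "in_strip \<alpha> \<beta> y w \<Longrightarrow> 0 \<le> y \<and> y < \<alpha> + \<beta>"
  by (cases w) auto

lemma in_strip_append:
  "in_strip \<alpha> \<beta> y (u @ v) \<longleftrightarrow> in_strip \<alpha> \<beta> y u \<and> in_strip \<alpha> \<beta> (y + rise \<alpha> \<beta> u) v"
  by (induction u arbitrary: y) (auto simp: add.assoc dest: in_strip_start)

lemma in_strip_concat_replicate:
  assumes "in_strip \<alpha> \<beta> y w" "rise \<alpha> \<beta> w = 0"
  shows "in_strip \<alpha> \<beta> y (concat (replicate k w))"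
  using assms by (induction k) (auto simp: in_strip_append dest: in_strip_start)

text \<open>The image \<open>ab\<close> has the net step of the old \<open>a\<close>. Its middle
  vertex \<open>y + \<alpha> + \<beta>\<close> stays below the new top because the old
  \<open>a\<close> ended below \<open>\<alpha> + \<beta>\<close>, that is,
  \<open>y < \<beta>\<close>.\<close>

lemma in_strip_MU:
  assumes "in_strip \<alpha> \<beta> y w" "0 \<le> \<alpha>" "0 \<le> \<beta>"
  shows "in_strip (\<alpha> + \<beta>) \<beta> y (apply_move MU w)"
  using assms
proof (induction w arbitrary: y)
  case (Cons l w)
  then show ?case by (cases l) (auto simp: apply_move_def dest: in_strip_start)
qed (simp add: apply_move_def)

text \<open>The image \<open>ab\<close> has the net step of the old \<open>b\<close>, and its middle
  vertex \<open>y + \<alpha>\<close> stays below the new top because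
  \<open>y < \<alpha> + \<beta>\<close>.\<close>

lemma in_strip_MV:
  assumes "in_strip \<alpha> \<beta> y w" "0 \<le> \<alpha>" "0 \<le> \<beta>"
  shows "in_strip \<alpha> (\<alpha> + \<beta>) y (apply_move MV w)"
  using assms
proof (induction w arbitrary: y)
  case (Cons l w)
  then show ?case by (cases l) (auto simp: apply_move_def dest: in_strip_start)
qed (simp add: apply_move_def)

lemma count_list_apply_move:
  "count_list (apply_move MU w) LA = count_list w LA"
  "count_list (apply_move MU w) LB = count_list w LA + count_list w LB"
  "count_list (apply_move MV w) LA = count_list w LA + count_list w LB"
  "count_list (apply_move MV w) LB = count_list w LB"
proof (induction w)
  case (Cons l w)
  { case 1 with Cons show ?case by (cases l) (auto simp: apply_move_def) }
  { case 2 with Cons show ?case by (cases l) (auto simp: apply_move_def) }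
  { case 3 with Cons show ?case by (cases l) (auto simp: apply_move_def) }
  { case 4 with Cons show ?case by (cases l) (auto simp: apply_move_def) }
qed (auto simp: apply_move_def)

text \<open>The letter counts change exactly as the step sizes do: each move adds one count to the
  other, which also preserves the gcd.\<close>

lemma apply_moves_in_strip:
  fixes \<Psi> :: "move list"
  defines "w \<equiv> apply_moves \<Psi> [LA, LB]"
  shows "in_strip (int (count_list w LB)) (int (count_list w LA)) 0 w
    \<and> coprime (count_list w LA) (count_list w LB)"
  unfolding w_def
proof (induction \<Psi>)
  case Nil
  show ?case by (simp add: apply_moves_def)
next
  case (Cons m \<Psi>)
  let ?w = "apply_moves \<Psi> [LA, LB]"
  have eq: "apply_moves (m # \<Psi>) [LA, LB] = apply_move m ?w" by (simp add: apply_moves_def)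
  show ?case
  proof (cases m)
    case MU
    with Cons in_strip_MU[of "int (count_list ?w LB)" "int (count_list ?w LA)" 0 ?w] show ?thesis
      unfolding eq by (auto simp: count_list_apply_move add.commute coprime_iff_gcd_eq_1)
  next
    case MV
    with Cons in_strip_MV[of "int (count_list ?w LB)" "int (count_list ?w LA)" 0 ?w] show ?thesis
      unfolding eq by (auto simp: count_list_apply_move add.commute coprime_iff_gcd_eq_1)
  qed
qed

text \<open>By coprimality the letter counts of a level path are a common multiple of
  \<open>p\<close> and \<open>q\<close>. This bounds from below the length of a nonempty path that
  returns to its level.\<close>

lemma level_word_length:
  assumes "coprime p q" and "rise (int q) (int p) w = 0"
  shows "p + q dvd length w"
proof (cases "p = 0")
  \<comment> \<open>Here \<open>p\<close> cannot be cancelled, but the divisor \<open>p + q\<close>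
    is 1.\<close>
  case True
  with assms have "q = 1" by simp
  with True show ?thesis by simp
next
  case False
  let ?i = "count_list w LA" and ?j = "count_list w LB"
  have "int (q * ?i) = int (p * ?j)" using assms(2) by (simp add: rise_eq_count)
  then have eq: "q * ?i = p * ?j" by (simp only: of_nat_eq_iff)
  then have "p dvd q * ?i" by simp
  then have "p dvd ?i" using assms(1) coprime_dvd_mult_right_iff by blast
  then obtain m where m: "?i = p * m" by blast
  with eq False have "?j = q * m" by (simp add: mult.left_commute)
  with m show ?thesis by (simp add: length_eq_count flip: distrib_right)
qed

section \<open>Chains of words\<close>

lemma chain_simps [simp]:
  "chain [] = []"
  "chain (l # w) = chain_of_letter l @ chain w"
  "chain (u @ v) = chain u @ chain v"
  by (auto simp: chain_def)

lemma chain_eq_Nil_iff [simp]: "chain w = [] \<longleftrightarrow> w = []"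
proof (cases w)
  case (Cons l v)
  then show ?thesis by (cases l) auto
qed simp

lemma rev_chain: "rev (chain w) = chain (rev w)"
proof (induction w)
  case (Cons l w)
  then show ?case by (cases l) auto
qed simp

lemma zero_notin_chain: "0 \<notin> set (chain w)"
proof (induction w)
  case (Cons l w)
  then show ?case by (cases l) auto
qed simp

section \<open>The order that \<open>rho\<close> induces on words\<close>

lemma rho_chain_pos: "w \<noteq> [] \<Longrightarrow> 0 < rho (chain w)"
proof (cases w)
  case (Cons l v)
  then show ?thesis using rho_nonneg[of "chain v"]
    by (cases l) (auto simp: rho_Cons intro!: divide_pos_pos add_pos_nonneg)
qed simp

lemma rho_LA: "rho (2 # 2 # B) = (2 + rho B) / (5 + 2 * rho B)"
proof -
  have "2 + rho B \<noteq> 0" "5 + 2 * rho B \<noteq> 0" using rho_nonneg[of B] by auto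
  then show ?thesis by (simp add: rho_Cons field_simps)
qed

lemma rho_LB: "rho (1 # 1 # B) = (1 + rho B) / (2 + rho B)"
proof -
  have "1 + rho B \<noteq> 0" "2 + rho B \<noteq> 0" using rho_nonneg[of B] by auto
  then show ?thesis by (simp add: rho_Cons field_simps)
qed

text \<open>Each partial quotient reverses the order, and a letter contributes two of them.\<close>

lemma rho_chain_Cons_mono:
  assumes "rho (chain u) \<le> rho (chain v)"
  shows "rho (chain (l # u)) \<le> rho (chain (l # v))"
  using assms rho_nonneg[of "chain u"]
  by (cases l) (simp_all add: rho_Cons frac_le divide_left_mono add_nonneg_pos add_pos_nonneg)

lemma rho_chain_LA_le_LB: "rho (chain (LA # u)) \<le> rho (chain (LB # v))"
proof -
  have "rho (chain (LA # u)) \<le> 1 / 2"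
    using rho_nonneg[of "chain u"] by (simp add: rho_LA field_simps)
  also have "1 / 2 \<le> rho (chain (LB # v))"
    using rho_nonneg[of "chain v"] by (simp add: rho_LB[unfolded One_nat_def] field_simps)
  finally show ?thesis .
qed

text \<open>A height that allows the step \<open>b\<close> is at least \<open>\<beta>\<close>, and one that allows \<open>a\<close> is below \<open>\<beta>\<close>;
  common letters keep the order of the heights.\<close>

lemma lower_path_rho_le:
  assumes "in_strip \<alpha> \<beta> y s" "in_strip \<alpha> \<beta> z t" "y \<le> z"
  shows "rho (chain s) \<le> rho (chain t) \<or> (\<exists>r. r \<noteq> [] \<and> s = t @ r)"
  using assms
proof (induction s arbitrary: t y z)
  case Nil
  \<comment> \<open>If \<open>s\<close> ends first, it has the least possible \<open>rho\<close>;
    only \<open>t\<close> ending first needs the exceptional alternative.\<close>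
  have "rho [] = 0" by (simp add: rho_def)
  then show ?case using rho_nonneg by simp
next
  case (Cons l s)
  show ?case
  proof (cases t)
    case Nil
    then show ?thesis by simp
  next
    case t: (Cons l' t')
    show ?thesis
    proof (cases "l = l'")
      case True
      with Cons.prems t have "rho (chain s) \<le> rho (chain t') \<or> (\<exists>r. r \<noteq> [] \<and> s = t' @ r)"
        by (intro Cons.IH[of "y + step \<alpha> \<beta> l" "z + step \<alpha> \<beta> l"]) auto
      then show ?thesis using True t rho_chain_Cons_mono[of s t' l] by auto
    next
      case False
      have "l = LA \<and> l' = LB"
      proof (rule ccontr)
        assume "\<not> (l = LA \<and> l' = LB)"
        with False have "l = LB" "l' = LA" by (cases l; cases l'; simp)+
        with Cons.prems t show False by (auto dest!: in_strip_start)
      qed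
      then show ?thesis using t rho_chain_LA_le_LB by blast
    qed
  qed
qed

lemma cut_of_chain:
  assumes "A @ c # B = chain w"
  obtains u l v where "w = u @ l # v" "A = chain u" "c # B = chain (l # v)"
  | u l v d where "w = u @ l # v" "chain_of_letter l = [d, d]" "A = chain u @ [d]"
      "c # B = d # chain v"
proof -
  have "\<exists>u l v. w = u @ l # v \<and> (A = chain u \<and> c # B = chain (l # v) \<or>
      (\<exists>d. chain_of_letter l = [d, d] \<and> A = chain u @ [d] \<and> c # B = d # chain v))"
    using assms
  proof (induction w arbitrary: A)
    case (Cons l w)
    obtain d where d: "chain_of_letter l = [d, d]" by (cases l) auto
    consider "A = []" | "A = [d]" | A' where "A = d # d # A'" "A' @ c # B = chain w"
      using Cons.prems d by (auto simp: Cons_eq_append_conv append_eq_Cons_conv)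
    then show ?case
    proof cases
      case 1
      with Cons.prems show ?thesis by (intro exI[of _ "[]"] exI[of _ l] exI[of _ w]) simp
    next
      case 2
      with Cons.prems d show ?thesis by (intro exI[of _ "[]"] exI[of _ l] exI[of _ w]) simp
    next
      case 3
      then obtain u l' v where "w = u @ l' # v" "A' = chain u \<and> c # B = chain (l' # v) \<or>
          (\<exists>d. chain_of_letter l' = [d, d] \<and> A' = chain u @ [d] \<and> c # B = d # chain v)"
        using Cons.IH by blast
      with 3 d show ?thesis by (intro exI[of _ "l # u"] exI[of _ l'] exI[of _ v]) auto
    qed
  qed simp
  then show thesis using that by blast
qed

section \<open>The optimal cut\<close>

lemma concat_replicate_shift:
  "v @ concat (replicate k (u @ v)) = concat (replicate k (v @ u)) @ v"
  by (induction k) auto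

lemma concat_replicate_commute: "concat (replicate k w) @ w = w @ concat (replicate k w)"
  by (induction k) auto

lemma rev_concat_replicate: "rev (concat (replicate k w)) = concat (replicate k (rev w))"
  by (induction k) (auto simp: concat_replicate_commute)

text \<open>Reversal gives powers of \<open>v @ u\<close> followed by \<open>v\<close>, which
  regroup to the original word.\<close>

lemma palindrome_power_append:
  assumes "palindrome u" "palindrome v"
  shows "rev (v @ concat (replicate k (u @ v))) = v @ concat (replicate k (u @ v))"
  using assms by (simp add: palindrome_def rev_concat_replicate concat_replicate_shift)

theorem theorem4p7:
  fixes \<Psi> :: "move list" and \<Pi>1 \<Pi>2 :: word and k :: nat
  assumes "apply_moves \<Psi> [LA, LB] = \<Pi>1 @ \<Pi>2"
    and "\<Pi>1 \<noteq> []" and "\<Pi>2 \<noteq> []"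
    and "palindrome \<Pi>1" and "palindrome \<Pi>2"
    and "k \<ge> 1"
  shows "Zfun (rho (chain (\<Pi>2 @ concat (replicate k (\<Pi>1 @ \<Pi>2)))))
       = inverse (cfrac (chain (\<Pi>1 @ \<Pi>2))
                  + rho (chain (\<Pi>2 @ concat (replicate (k - 1) (\<Pi>1 @ \<Pi>2)))))"
proof -
  define \<Pi> where "\<Pi> = \<Pi>1 @ \<Pi>2"
  define T where "T = \<Pi>2 @ concat (replicate (k - 1) \<Pi>)"
  define W where "W = \<Pi>2 @ concat (replicate k \<Pi>)"
  define p q where pq: "p = count_list \<Pi> LA" "q = count_list \<Pi> LB"
  let ?rise = "rise (int q) (int p)" and ?in_strip = "in_strip (int q) (int p)"
  \<comment> \<open>The height at which \<open>\<Pi>1\<close> meets \<open>\<Pi>2\<close>. Started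
    there, the path of \<open>W\<close> is at height 0 before each copy of
    \<open>\<Pi>\<close>.\<close>
  define x where "x = ?rise \<Pi>1"
  obtain j where k: "k = Suc j" using assms(6) by (cases k) auto
  have WT: "W = T @ \<Pi>" by (simp add: W_def T_def k concat_replicate_commute)
  have revT: "rev T = T" and revW: "rev W = W"
    using palindrome_power_append[OF assms(4,5)] by (simp_all only: T_def W_def \<Pi>_def)
  have strip\<Pi>: "?in_strip 0 \<Pi>" and cop: "coprime p q"
    using apply_moves_in_strip[of \<Psi>] by (simp_all add: assms(1) pq \<Pi>_def)
  have rise\<Pi>: "?rise \<Pi> = 0" by (simp add: rise_eq_count pq)
  then have rise2: "?rise \<Pi>2 = - x" by (simp add: \<Pi>_def x_def)
  then have riseT: "?rise T = - x" by (simp add: T_def rise\<Pi>)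
  then have riseW: "?rise W = - x" by (simp add: WT rise\<Pi>)
  have "?in_strip x \<Pi>2" using strip\<Pi> by (simp add: \<Pi>_def in_strip_append x_def)
  then have stripW: "?in_strip x W"
    using in_strip_concat_replicate[OF strip\<Pi> rise\<Pi>] by (simp add: W_def in_strip_append rise2)
  then have stripT: "?in_strip x T" by (simp add: WT in_strip_append)
  have len: "length \<Pi> = p + q" by (simp add: length_eq_count pq)
  have returns: "length r \<ge> length \<Pi>" if "?rise r = 0" "r \<noteq> []" for r
    using level_word_length[OF cop that(1)] that(2) by (auto simp: len dest: dvd_imp_le)

  have suffix_ge: "rho (chain \<Pi>) \<le> rho (chain v)" if "W = u @ v" "v \<noteq> []" for u v
  proof -
    define y where "y = x + ?rise u"
    have v: "?in_strip y v" "?rise v = - y"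
      using stripW riseW that(1) by (auto simp: in_strip_append y_def)
    \<comment> \<open>If \<open>v\<close> were a proper prefix of \<open>\<Pi>\<close>, it would
      lead from 0 to \<open>- y\<close>; the strip forces \<open>y = 0\<close>, and \<open>v\<close>
      would return to its level too early.\<close>
    have False if r: "r \<noteq> []" "\<Pi> = v @ r" for r
    proof -
      have "0 \<le> - y" using strip\<Pi> r v in_strip_start by (fastforce simp: in_strip_append)
      then have "y = 0" using in_strip_start[OF v(1)] by simp
      then show False using returns[of v] v r \<open>v \<noteq> []\<close> by simp
    qed
    then show ?thesis
      using lower_path_rho_le[OF strip\<Pi> v(1)] in_strip_start[OF v(1)] by blast
  qed

  have prefix_le: "rho (chain (rev u)) \<le> rho (chain T)" if "W = u @ v" "v \<noteq> []" for u v
  proof -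
    define y where "y = - ?rise u"
    have "0 \<le> x + ?rise u" using stripW that(1) in_strip_start by (auto simp: in_strip_append)
    then have yx: "y \<le> x" by (simp add: y_def)
    \<comment> \<open>Since \<open>W\<close> is a palindrome, \<open>rev u\<close> is a suffix of
      it, and its path starts at height \<open>y\<close>.\<close>
    have W': "W = rev v @ rev u" using that(1) revW by (metis rev_append)
    moreover have "x + ?rise v = y" using riseW that(1) by (simp add: y_def)
    ultimately have u: "?in_strip y (rev u)" using stripW by (simp add: in_strip_append)
    \<comment> \<open>After \<open>T\<close> the height is \<open>y - x\<close>, so the strip forces
      \<open>y = x\<close> and \<open>r\<close> is level. Then \<open>r\<close> is at least as long
      as \<open>\<Pi>\<close>, leaving no room for \<open>v\<close> in \<open>W\<close>.\<close>
    have False if r: "r \<noteq> []" "rev u = T @ r" for r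
    proof -
      have "0 \<le> y - x" using u r riseT in_strip_start by (fastforce simp: in_strip_append)
      then have "y = x" using yx by simp
      moreover have "?rise (rev u) = ?rise T + ?rise r" using r by simp
      ultimately have "?rise r = 0" using riseT y_def by simp
      then have "length r \<ge> length \<Pi>" using returns r by blast
      moreover have "length T + length \<Pi> = length v + (length T + length r)"
        using W' WT r by (metis length_append length_rev)
      ultimately show False using \<open>v \<noteq> []\<close> by simp
    qed
    then show ?thesis using lower_path_rho_le[OF u stripT yx] by blast
  qed

  have between: "cfrac (chain v) + rho (chain (rev u)) \<le> cfrac (chain \<Pi>) + rho (chain T)"
    if "W = u @ v" "v \<noteq> []" for u v
  proof -
    have "\<Pi> \<noteq> []" using assms(2) by (simp add: \<Pi>_def)
    then have "cfrac (chain v) \<le> cfrac (chain \<Pi>)"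
      using suffix_ge[OF that] rho_chain_pos[of \<Pi>] that(2)
      by (simp add: cfrac_eq_inverse_rho le_imp_inverse_le)
    then show ?thesis using prefix_le[OF that] by simp
  qed

  obtain c0 B0 where cB0: "chain \<Pi> = c0 # B0"
    using assms(2) by (cases "chain \<Pi>") (auto simp: \<Pi>_def)
  \<comment> \<open>As \<open>T\<close> is a palindrome, the reversed left part of this cut is
    \<open>chain T\<close> itself.\<close>
  have chainW: "rev (chain T) @ c0 # B0 = chain W" by (simp add: WT cB0 rev_chain revT)
  have "cfrac (c # B) + rho R \<le> cfrac (c0 # B0) + rho (chain T)"
    if cut: "rev R @ c # B = rev (chain T) @ c0 # B0" for R c B
  proof -
    have "rev R @ c # B = chain W" using cut chainW by simp
    then show ?thesis
    proof (cases rule: cut_of_chain)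
      case (1 u l v)
      then have "R = chain (rev u)" by (metis rev_chain rev_rev_ident)
      with 1 between[of u "l # v"] show ?thesis by (simp add: cB0)
    next
      case (2 u l v d)
      then have R: "R = d # chain (rev u)" by (metis rev_chain rev_eq_Cons_iff rev_swap)
      \<comment> \<open>In the mirrored cut the other \<open>d\<close> of the split letter stands
        alone as integer part; both cuts have the value
        \<open>d + rho (chain v) + 1 / (d + rho (chain (rev u)))\<close>.\<close>
      have "W = rev v @ l # rev u" using revW 2(1) by (metis rev.simps(2) rev_append append_assoc append_Cons append_Nil)
      then have "cfrac (chain (l # rev u)) + rho (chain v) \<le> cfrac (chain \<Pi>) + rho (chain T)"
        using between[of "rev v" "l # rev u"] by simp
      moreover have "cfrac (c # B) + rho R = cfrac (chain (l # rev u)) + rho (chain v)"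
        using 2 R by (simp add: cfrac_Cons_rho rho_Cons)
      ultimately show ?thesis by (simp add: cB0)
    qed
  qed
  then have "Zfun (rho (rev (chain T) @ c0 # B0)) = inverse (cfrac (c0 # B0) + rho (chain T))"
  proof (intro Zfun_rho_eq_max_cut)
    show "0 \<notin> set (rev (chain T) @ c0 # B0)" using chainW zero_notin_chain by simp
    show "chain T \<noteq> []" using assms(3) by (simp add: T_def)
  qed
  then have "Zfun (rho (chain W)) = inverse (cfrac (chain \<Pi>) + rho (chain T))"
    by (simp only: chainW cB0)
  then show ?thesis by (simp only: W_def T_def \<Pi>_def)
qed

end
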